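(* Let $\Gamma$ be a finite graph and let $G\leq\mathrm{Aut}(\Gamma)$. For $g\in G$ let $[g]$ denote the conjugacy class of $g$ in $G$ and let $c_G(g):=\sum_{H\leq G,\ g\in H}\frac{1}{|H|}$. Then $$F_{\Gamma}(G;x,y)=\sum_{[g]\subseteq G}|[g]|\,c_G(g)\,P_{\Gamma/g}(x,y),$$ where the sum runs over the conjugacy classes of $G$, $g$ being any representative of its class.
   Context: Graphs are finite and undirected; loops are allowed and parallel edges are irrelevant (only adjacency matters). For a graph $\Lambda$, the bivariate chromatic polynomial $P_\Lambda(x,y)$ (Dohmen–Pönitz–Tittmann) is the unique polynomial in $x,y$ such that, for all integers $x\ge y\ge 0$, $P_\Lambda(x,y)$ is the number of maps $c:V(\Lambda)\to\{1,\dots,x\}$ such that for every edge $uv$ of $\Lambda$ (including loops, $u=v$) with $c(u)=c(v)$ one has $c(u)>y$. Thus colours $1,\dots,y$ are "proper", colours $y+1,\dots,x$ are "improper", and a vertex carrying a loop can only receive an improper colour. For $g\in G$, the quotient graph $\Gamma/g$ has as vertices the $\langle g\rangle$-orbits on $V(\Gamma)$; two distinct orbits are adjacent iff at least one edge of $\Gamma$ joins them, and an orbit carries a loop iff some edge of $\Gamma$ has both endpoints in that orbit. The multiorbital bivariate chromatic polynomial of $\Gamma$ relative to $G$ is $$F_\Gamma(G;x,y):=\sum_{H\le G}\frac1{|H|}\sum_{h\in H}P_{\Gamma/h}(x,y),$$ the outer sum being over all subgroups $H$ of $G$. The sum defining $c_G(g)$ ranges over all subgroups $H$ of $G$ containing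 $g$. Identities are identities of polynomials in $x,y$ with rational coefficients. *)

theory Defs
  imports
    "HOL-Algebra.Algebra"
    "HOL-Computational_Algebra.Polynomial"
    "Graph_Theory.Pair_Digraph"
begin

text \<open>
  Graphs are the finite symmetric pair digraphs of the locale \<^locale>\<open>pair_pseudo_graph\<close>:
  loops are allowed, and an undirected edge between u and v is the pair of arcs (u, v), (v, u).
\<close>

definition graph_aut :: "'a pair_pre_digraph \<Rightarrow> ('a \<Rightarrow> 'a) set" where
  "graph_aut \<Gamma> = {f \<in> Bij (pverts \<Gamma>).
     \<forall>u\<in>pverts \<Gamma>. \<forall>v\<in>pverts \<Gamma>. (f u, f v) \<in> parcs \<Gamma> \<longleftrightarrow> (u, v) \<in> parcs \<Gamma>}"

definition aut_group :: "'a pair_pre_digraph \<Rightarrow> ('a \<Rightarrow> 'a) monoid" where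
  "aut_group \<Gamma> = BijGroup (pverts \<Gamma>) \<lparr>carrier := graph_aut \<Gamma>\<rparr>"

definition cyclic_orbits :: "'a pair_pre_digraph \<Rightarrow> ('a \<Rightarrow> 'a) \<Rightarrow> 'a set set" where
  "cyclic_orbits \<Gamma> g =
     orbits (aut_group \<Gamma> \<lparr>carrier := generate (aut_group \<Gamma>) {g}\<rparr>) (pverts \<Gamma>) (\<lambda>f. f)"

text \<open>The case A = B below gives the loops of the quotient graph.\<close>

definition quotient_graph :: "'a pair_pre_digraph \<Rightarrow> ('a \<Rightarrow> 'a) \<Rightarrow> 'a set pair_pre_digraph" where
  "quotient_graph \<Gamma> g =
     \<lparr>pverts = cyclic_orbits \<Gamma> g,
      parcs = {(A, B). A \<in> cyclic_orbits \<Gamma> g \<and> B \<in> cyclic_orbits \<Gamma> g \<and>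
                 (\<exists>u\<in>A. \<exists>v\<in>B. (u, v) \<in> parcs \<Gamma>)}\<rparr>"

definition bichromatic_colourings :: "'a pair_pre_digraph \<Rightarrow> nat \<Rightarrow> nat \<Rightarrow> ('a \<Rightarrow> nat) set" where
  "bichromatic_colourings \<Lambda> x y =
     {c \<in> pverts \<Lambda> \<rightarrow>\<^sub>E {1..x}. \<forall>(u, v)\<in>parcs \<Lambda>. c u = c v \<longrightarrow> y < c u}"

text \<open>
  Polynomials in x and y are elements of (\<rat>[y])[x]: the outer indeterminate is x and the
  coefficients are polynomials in y.
\<close>

definition poly2 :: "rat poly poly \<Rightarrow> rat \<Rightarrow> rat \<Rightarrow> rat" where
  "poly2 P x y = poly (poly P [:x:]) y"

text \<open>Existence and uniqueness are shown in \<open>bivariate_chromatic_ex1\<close> below.\<close>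

definition bivariate_chromatic :: "'a pair_pre_digraph \<Rightarrow> rat poly poly" where
  "bivariate_chromatic \<Lambda> = (THE P. \<forall>x y. y \<le> x \<longrightarrow>
     poly2 P (of_nat x) (of_nat y) = of_nat (card (bichromatic_colourings \<Lambda> x y)))"

definition multiorbital_bivariate_chromatic ::
    "'a pair_pre_digraph \<Rightarrow> ('a \<Rightarrow> 'a) set \<Rightarrow> rat poly poly" where
  "multiorbital_bivariate_chromatic \<Gamma> G =
     (\<Sum>H | subgroup H (aut_group \<Gamma> \<lparr>carrier := G\<rparr>).
        smult [:1 / of_nat (card H):] (\<Sum>h\<in>H. bivariate_chromatic (quotient_graph \<Gamma> h)))"

definition conjugacy_classes :: "('g, 'b) monoid_scheme \<Rightarrow> 'g set set" where
  "conjugacy_classes G =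
     orbits G (carrier G) (\<lambda>g. \<lambda>h\<in>carrier G. g \<otimes>\<^bsub>G\<^esub> h \<otimes>\<^bsub>G\<^esub> inv\<^bsub>G\<^esub> g)"

definition subgroup_weight :: "('g, 'b) monoid_scheme \<Rightarrow> 'g \<Rightarrow> rat" where
  "subgroup_weight G g = (\<Sum>H | subgroup H G \<and> g \<in> H. 1 / of_nat (card H))"


subsection \<open>Well-definedness\<close>

lemma subgroup_graph_aut: "subgroup (graph_aut \<Gamma>) (BijGroup (pverts \<Gamma>))"
proof -
  let ?V = "pverts \<Gamma>"
  interpret group "BijGroup ?V" by (rule group_BijGroup)
  show ?thesis
  proof (rule subgroupI)
    show "graph_aut \<Gamma> \<subseteq> carrier (BijGroup ?V)"
      by (auto simp: graph_aut_def BijGroup_def)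
    show "graph_aut \<Gamma> \<noteq> {}"
      using id_Bij[of ?V] by (auto simp: graph_aut_def intro!: exI[of _ "\<lambda>x\<in>?V. x"])
  next
    fix f assume f: "f \<in> graph_aut \<Gamma>"
    then have fB: "f \<in> Bij ?V" and bij: "bij_betw f ?V ?V"
      and e: "\<And>u v. u \<in> ?V \<Longrightarrow> v \<in> ?V \<Longrightarrow> (f u, f v) \<in> parcs \<Gamma> \<longleftrightarrow> (u, v) \<in> parcs \<Gamma>"
      by (auto simp: graph_aut_def Bij_def)
    have inv: "inv\<^bsub>BijGroup ?V\<^esub> f = (\<lambda>x\<in>?V. inv_into ?V f x)"
      using fB by (rule inv_BijGroup)
    show "inv\<^bsub>BijGroup ?V\<^esub> f \<in> graph_aut \<Gamma>"
      unfolding inv graph_aut_def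
    proof (intro CollectI conjI ballI)
      show "(\<lambda>x\<in>?V. inv_into ?V f x) \<in> Bij ?V"
        using fB by (rule restrict_inv_into_Bij)
      fix u v assume uv: "u \<in> ?V" "v \<in> ?V"
      then have "inv_into ?V f u \<in> ?V" "inv_into ?V f v \<in> ?V"
        "f (inv_into ?V f u) = u" "f (inv_into ?V f v) = v"
        using bij by (auto simp: bij_betw_def inv_into_into f_inv_into_f)
      then show "((\<lambda>x\<in>?V. inv_into ?V f x) u, (\<lambda>x\<in>?V. inv_into ?V f x) v) \<in> parcs \<Gamma>
          \<longleftrightarrow> (u, v) \<in> parcs \<Gamma>"
        using e[of "inv_into ?V f u" "inv_into ?V f v"] uv by simp
    qed
  next
    fix f g assume fg: "f \<in> graph_aut \<Gamma>" "g \<in> graph_aut \<Gamma>"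
    then have "f \<in> Bij ?V" "g \<in> Bij ?V" by (auto simp: graph_aut_def)
    moreover from this have "\<And>u. u \<in> ?V \<Longrightarrow> g u \<in> ?V" by (auto simp: Bij_def bij_betw_def)
    ultimately show "f \<otimes>\<^bsub>BijGroup ?V\<^esub> g \<in> graph_aut \<Gamma>"
      using fg by (auto simp: BijGroup_def graph_aut_def compose_Bij compose_eq)
  qed
qed

lemma group_aut_group: "group (aut_group \<Gamma>)"
  unfolding aut_group_def
  by (rule group.subgroup_imp_group[OF group_BijGroup subgroup_graph_aut])

lemma pair_pseudo_graph_quotient_graph:
  assumes "pair_pseudo_graph \<Gamma>"
  shows "pair_pseudo_graph (quotient_graph \<Gamma> g)"
proof -
  interpret pair_pseudo_graph \<Gamma> by fact
  have fin: "finite (cyclic_orbits \<Gamma> g)"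
    using pair_finite_verts unfolding cyclic_orbits_def orbits_def by simp
  have sym: "(v, u) \<in> parcs \<Gamma>" if "(u, v) \<in> parcs \<Gamma>" for u v
    using pair_sym_arcs that by (auto simp: symmetric_def elim: symE)
  have "finite (parcs (quotient_graph \<Gamma> g))"
    by (rule finite_subset[OF _ finite_cartesian_product[OF fin fin]])
       (auto simp: quotient_graph_def)
  moreover have "sym (parcs (quotient_graph \<Gamma> g))"
    by (rule symI) (auto simp: quotient_graph_def dest: sym)
  ultimately show ?thesis
    using fin
    by unfold_locales (auto simp: quotient_graph_def symmetric_def sym_def)
qed

lemma poly2_simps [simp]:
  "poly2 0 x y = 0" "poly2 1 x y = 1"
  "poly2 (P + Q) x y = poly2 P x y + poly2 Q x y"
  "poly2 (P - Q) x y = poly2 P x y - poly2 Q x y"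
  "poly2 (P * Q) x y = poly2 P x y * poly2 Q x y"
  "poly2 [:0, 1:] x y = x" "poly2 [:[:0, 1:]:] x y = y"
  by (simp_all add: poly2_def)

lemma poly2_prod: "poly2 (\<Prod>i\<in>A. P i) x y = (\<Prod>i\<in>A. poly2 (P i) x y)"
  by (induction A rule: infinite_finite_induct) auto

lemma poly2_eqI:
  assumes "\<And>x y :: nat. y \<le> x \<Longrightarrow> poly2 P (of_nat x) (of_nat y) = poly2 Q (of_nat x) (of_nat y)"
  shows "P = Q"
proof -
  define R where "R = P - Q"
  have z: "poly2 R (of_nat x) (of_nat y) = 0" if "y \<le> x" for x y :: nat
    using assms[OF that] by (simp add: R_def)
  have inf: "infinite (of_nat ` {y..} :: rat set)" for y :: nat
    by (subst finite_image_iff) (auto simp: inj_on_def infinite_Ici)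
  have ev: "poly2 R x y = poly (map_poly (\<lambda>p. poly p y) R) x" for x y
    by (induction R) (simp_all add: poly2_def map_poly_pCons)
  have "map_poly (\<lambda>p. poly p (of_nat y)) R = 0" for y :: nat
  proof (rule ccontr)
    assume "map_poly (\<lambda>p. poly p (of_nat y)) R \<noteq> 0"
    then have "finite {x. poly (map_poly (\<lambda>p. poly p (of_nat y)) R) x = 0}"
      by (rule poly_roots_finite)
    moreover have "of_nat ` {y..} \<subseteq> {x. poly (map_poly (\<lambda>p. poly p (of_nat y)) R) x = 0}"
      using z by (auto simp: ev)
    ultimately show False using inf finite_subset by blast
  qed
  then have c: "poly (coeff R n) (of_nat y) = 0" for n and y :: nat
    by (metis coeff_0 coeff_map_poly poly_0)
  have "coeff R n = 0" for n
  proof (rule ccontr)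
    assume "coeff R n \<noteq> 0"
    then have "finite {x. poly (coeff R n) x = 0}" by (rule poly_roots_finite)
    moreover have "of_nat ` {0..} \<subseteq> {x. poly (coeff R n) x = 0}" using c by auto
    ultimately show False using inf finite_subset by blast
  qed
  then have "R = 0" by (simp add: poly_eq_iff)
  then show ?thesis by (simp add: R_def)
qed

lemma bichromatic_all_bad:
  assumes "finite V" "F \<subseteq> V \<times> V"
  shows "\<exists>P. \<forall>x y :: nat. y \<le> x \<longrightarrow> poly2 P (of_nat x) (of_nat y) =
    of_nat (card {c \<in> V \<rightarrow>\<^sub>E {1..x}. \<forall>(u, v)\<in>F. c u = c v \<and> c u \<le> y})"
  using assms
proof (induction "card V" arbitrary: V F rule: less_induct)
  case less
  show ?case
  proof (cases "\<exists>u v. (u, v) \<in> F \<and> u \<noteq> v")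
    case True
    then obtain u v where uv: "(u, v) \<in> F" "u \<noteq> v" "u \<in> V" "v \<in> V" using less.prems by auto
    define r where "r w = (if w = v then u else w)" for w
    have rV: "r w \<in> V - {v}" if "w \<in> V" for w
      using that uv by (simp add: r_def)
    define F' where "F' = map_prod r r ` F"
    have "card (V - {v}) < card V" using uv less.prems by (meson card_Diff1_less)
    moreover have "F' \<subseteq> (V - {v}) \<times> (V - {v})"
    proof
      fix p assume "p \<in> F'"
      then obtain a b where "(a, b) \<in> F" "p = (r a, r b)" by (auto simp: F'_def)
      moreover from this have "a \<in> V" "b \<in> V" using less.prems(2) by blast+
      ultimately show "p \<in> (V - {v}) \<times> (V - {v})" using rV by simp
    qed
    moreover have "card {c \<in> V \<rightarrow>\<^sub>E {1..x}. \<forall>(u, v)\<in>F. c u = c v \<and> c u \<le> y} =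
        card {c \<in> (V - {v}) \<rightarrow>\<^sub>E {1..x}. \<forall>(u, v)\<in>F'. c u = c v \<and> c u \<le> y}" (is "card ?A = card ?B")
      for x y :: nat
    proof (rule bij_betw_same_card[OF bij_betw_byWitness[where
          f = "\<lambda>c. restrict c (V - {v})" and f' = "\<lambda>c. \<lambda>w\<in>V. c (r w)"]])
      have A1: "c \<in> V \<rightarrow>\<^sub>E {1..x}" if "c \<in> ?A" for c using that by blast
      have A2: "c a = c b \<and> c a \<le> y" if "c \<in> ?A" "(a, b) \<in> F" for c a b using that by blast
      have B1: "c \<in> (V - {v}) \<rightarrow>\<^sub>E {1..x}" if "c \<in> ?B" for c using that by blast
      have B2: "c a = c b \<and> c a \<le> y" if "c \<in> ?B" "(a, b) \<in> F'" for c a b using that by blast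
      have cr: "c (r w) = c w" if "c \<in> ?A" for c w
        using A2[OF that uv(1)] by (simp add: r_def)
      show "\<forall>c\<in>?A. (\<lambda>c. \<lambda>w\<in>V. c (r w)) ((\<lambda>c. restrict c (V - {v})) c) = c"
      proof
        fix c assume c: "c \<in> ?A"
        show "(\<lambda>c. \<lambda>w\<in>V. c (r w)) ((\<lambda>c. restrict c (V - {v})) c) = c"
        proof
          fix w
          show "(\<lambda>c. \<lambda>w\<in>V. c (r w)) ((\<lambda>c. restrict c (V - {v})) c) w = c w"
            using cr[OF c, of w] rV[of w] PiE_arb[OF A1[OF c], of w] by (cases "w \<in> V") auto
        qed
      qed
      show "\<forall>c\<in>?B. (\<lambda>c. restrict c (V - {v})) ((\<lambda>c. \<lambda>w\<in>V. c (r w)) c) = c"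
      proof
        fix c assume c: "c \<in> ?B"
        show "(\<lambda>c. restrict c (V - {v})) ((\<lambda>c. \<lambda>w\<in>V. c (r w)) c) = c"
        proof
          fix w
          show "(\<lambda>c. restrict c (V - {v})) ((\<lambda>c. \<lambda>w\<in>V. c (r w)) c) w = c w"
            using PiE_arb[OF B1[OF c], of w] by (cases "w \<in> V - {v}") (auto simp: r_def)
        qed
      qed
      show "(\<lambda>c. restrict c (V - {v})) ` ?A \<subseteq> ?B"
      proof (rule image_subsetI, rule CollectI, rule conjI)
        fix c assume c: "c \<in> ?A"
        show "restrict c (V - {v}) \<in> (V - {v}) \<rightarrow>\<^sub>E {1..x}"
          using PiE_mem[OF A1[OF c]] by (simp add: PiE_def Pi_def)
        have "restrict c (V - {v}) (r a) = restrict c (V - {v}) (r b) \<and>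
              restrict c (V - {v}) (r a) \<le> y" if "(a, b) \<in> F" for a b
        proof -
          have "a \<in> V" "b \<in> V" using that less.prems(2) by blast+
          then show ?thesis using rV[of a] rV[of b] A2[OF c that] cr[OF c, of a] cr[OF c, of b] by simp
        qed
        then show "\<forall>(a, b)\<in>F'. restrict c (V - {v}) a = restrict c (V - {v}) b \<and>
            restrict c (V - {v}) a \<le> y"
          unfolding F'_def by fast
      qed
      show "(\<lambda>c. \<lambda>w\<in>V. c (r w)) ` ?B \<subseteq> ?A"
      proof (rule image_subsetI, rule CollectI, rule conjI)
        fix c assume c: "c \<in> ?B"
        show "(\<lambda>w\<in>V. c (r w)) \<in> V \<rightarrow>\<^sub>E {1..x}"
          using PiE_mem[OF B1[OF c]] rV by (simp add: PiE_def Pi_def)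
        have "c (r a) = c (r b) \<and> c (r a) \<le> y" if "(a, b) \<in> F" for a b
          using B2[OF c, of "r a" "r b"] that by (force simp: F'_def)
        moreover have "a \<in> V \<and> b \<in> V" if "(a, b) \<in> F" for a b
          using that less.prems(2) by blast
        ultimately show "\<forall>(a, b)\<in>F. (\<lambda>w\<in>V. c (r w)) a = (\<lambda>w\<in>V. c (r w)) b \<and>
            (\<lambda>w\<in>V. c (r w)) a \<le> y"
          by auto
      qed
    qed
    ultimately show ?thesis using less.hyps[of "V - {v}" F'] less.prems by simp
  next
    case False
    have eq: "{c \<in> V \<rightarrow>\<^sub>E {1..x}. \<forall>(u, v)\<in>F. c u = c v \<and> c u \<le> y} =
        (\<Pi>\<^sub>E v\<in>V. if (v, v) \<in> F then {1..y} else {1..x})" if "y \<le> x" for x y :: nat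
    proof (intro subset_antisym subsetI)
      fix c assume "c \<in> {c \<in> V \<rightarrow>\<^sub>E {1..x}. \<forall>(u, v)\<in>F. c u = c v \<and> c u \<le> y}"
      then have cV: "c \<in> V \<rightarrow>\<^sub>E {1..x}" and cF: "\<And>v. (v, v) \<in> F \<Longrightarrow> c v \<le> y" by blast+
      show "c \<in> (\<Pi>\<^sub>E v\<in>V. if (v, v) \<in> F then {1..y} else {1..x})"
        using PiE_mem[OF cV] PiE_arb[OF cV] cF by (intro PiE_I) auto
    next
      fix c assume c: "c \<in> (\<Pi>\<^sub>E v\<in>V. if (v, v) \<in> F then {1..y} else {1..x})"
      have m: "c v \<in> (if (v, v) \<in> F then {1..y} else {1..x})" if "v \<in> V" for v
        using c that by (rule PiE_mem)
      have "c v \<in> {1..x}" if "v \<in> V" for v using m[OF that] \<open>y \<le> x\<close> by (auto split: if_splits)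
      moreover have "c u = c v \<and> c u \<le> y" if "(u, v) \<in> F" for u v
      proof -
        have "u = v" "v \<in> V" using that False less.prems by auto
        then show ?thesis using m[of v] that by simp
      qed
      moreover have "c \<in> extensional V" using c by (simp add: PiE_def)
      ultimately show "c \<in> {c \<in> V \<rightarrow>\<^sub>E {1..x}. \<forall>(u, v)\<in>F. c u = c v \<and> c u \<le> y}"
        unfolding PiE_def Pi_def by fast
    qed
    show ?thesis
    proof (intro exI allI impI)
      fix x y :: nat assume "y \<le> x"
      show "poly2 (\<Prod>v\<in>V. if (v, v) \<in> F then [:[:0, 1:]:] else [:0, 1:]) (of_nat x) (of_nat y) =
        of_nat (card {c \<in> V \<rightarrow>\<^sub>E {1..x}. \<forall>(u, v)\<in>F. c u = c v \<and> c u \<le> y})"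
        unfolding eq[OF \<open>y \<le> x\<close>] using less.prems
        by (simp add: poly2_prod card_PiE if_distrib[of card] if_distrib[of of_nat]
              if_distrib[of "\<lambda>p. poly2 p _ _"] cong: if_cong)
    qed
  qed
qed

lemma bichromatic_count:
  assumes "finite E" "finite V" "E \<subseteq> V \<times> V" "F \<subseteq> V \<times> V"
  shows "\<exists>P. \<forall>x y :: nat. y \<le> x \<longrightarrow> poly2 P (of_nat x) (of_nat y) =
    of_nat (card {c \<in> V \<rightarrow>\<^sub>E {1..x}. (\<forall>(u, v)\<in>E. c u = c v \<longrightarrow> y < c u) \<and>
      (\<forall>(u, v)\<in>F. c u = c v \<and> c u \<le> y)})"
  using assms
proof (induction E arbitrary: F rule: finite_induct)
  case empty
  then show ?case using bichromatic_all_bad[of V F] by simp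
next
  case (insert e E)
  define N where "N E F x y = {c \<in> V \<rightarrow>\<^sub>E {1..x}. (\<forall>(u, v)\<in>E. c u = c v \<longrightarrow> y < c u) \<and>
      (\<forall>(u, v)\<in>F. c u = c v \<and> c u \<le> y)}" for E F and x y :: nat
  have fin: "finite (N E F x y)" for E F x y
    using finite_PiE[OF \<open>finite V\<close>, of "\<lambda>_. {1..x}"] by (simp add: N_def)
  obtain P where P: "\<And>x y :: nat. y \<le> x \<Longrightarrow>
      poly2 P (of_nat x) (of_nat y) = of_nat (card (N E F x y))"
    using insert.IH[of F] insert.prems unfolding N_def by auto
  obtain Q where Q: "\<And>x y :: nat. y \<le> x \<Longrightarrow>
      poly2 Q (of_nat x) (of_nat y) = of_nat (card (N E (insert e F) x y))"
    using insert.IH[of "insert e F"] insert.prems unfolding N_def by auto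
  obtain a b where e: "e = (a, b)" by (cases e)
  have ins: "c \<in> N (insert e E) F x y \<longleftrightarrow> c \<in> N E F x y \<and> \<not> (c a = c b \<and> c a \<le> y)"
    "c \<in> N E (insert e F) x y \<longleftrightarrow> c \<in> N E F x y \<and> c a = c b \<and> c a \<le> y" for c x y
    unfolding N_def e not_le[symmetric] by blast+
  have split: "N E F x y = N (insert e E) F x y \<union> N E (insert e F) x y"
    "N (insert e E) F x y \<inter> N E (insert e F) x y = {}" for x y
    using ins by blast+
  have "card (N E F x y) = card (N (insert e E) F x y) + card (N E (insert e F) x y)" for x y
    by (subst split(1), rule card_Un_disjoint) (auto simp: fin split(2))
  then have "poly2 (P - Q) (of_nat x) (of_nat y) = of_nat (card (N (insert e E) F x y))"
    if "y \<le> x" for x y :: nat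
    using P[OF that] Q[OF that] by simp
  then show ?case unfolding N_def by blast
qed

lemma bivariate_chromatic_ex1:
  assumes "pair_pseudo_graph \<Lambda>"
  shows "\<exists>!P. \<forall>x y. y \<le> x \<longrightarrow>
    poly2 P (of_nat x) (of_nat y) = of_nat (card (bichromatic_colourings \<Lambda> x y))"
proof -
  interpret pair_pseudo_graph \<Lambda> by fact
  have "parcs \<Lambda> \<subseteq> pverts \<Lambda> \<times> pverts \<Lambda>" by (auto dest: in_arcsD1 in_arcsD2)
  then show ?thesis
    using bichromatic_count[of "parcs \<Lambda>" "pverts \<Lambda>" "{}"] pair_finite_verts pair_finite_arcs
    by (intro ex_ex1I) (auto simp: bichromatic_colourings_def intro!: poly2_eqI)
qed

lemma bivariate_chromatic:
  assumes "pair_pseudo_graph \<Lambda>" "y \<le> x"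
  shows "poly2 (bivariate_chromatic \<Lambda>) (of_nat x) (of_nat y) =
    of_nat (card (bichromatic_colourings \<Lambda> x y))"
  using theI'[OF bivariate_chromatic_ex1[OF assms(1)]] assms(2)
  unfolding bivariate_chromatic_def by blast

end

theory Submission
  imports Defs
begin

text \<open>
  Collecting the double sum over pairs \<open>h \<in> H \<le> G\<close> by \<open>h\<close> gives
  \<open>F = (\<Sum>g\<in>G. c(g) P(\<Gamma>/g))\<close>, where \<open>c(g)\<close> is the sum of \<open>1/|H|\<close> over the subgroups containing \<open>g\<close>.
  It remains to see that the summand depends only on the conjugacy class of \<open>g\<close>. Conjugation by
  \<open>k \<in> G\<close> permutes the subgroups of \<open>G\<close>, preserves their orders, and takes those containing \<open>g\<close> to
  those containing \<open>kgk\<^sup>-\<^sup>1\<close>, so \<open>c\<close> is a class function (\<open>subgroup_weight_conj\<close>). On the graph side,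
  \<open>k\<close> carries the orbits of \<open>\<langle>g\<rangle>\<close> to the orbits of \<open>\<langle>kgk\<^sup>-\<^sup>1\<rangle>\<close> and is an automorphism of \<open>\<Gamma>\<close>, so it
  induces an isomorphism from \<open>\<Gamma>/g\<close> to \<open>\<Gamma>/kgk\<^sup>-\<^sup>1\<close>, and isomorphic graphs have the same
  polynomial (\<open>bivariate_chromatic_quotient_conj\<close>). As the classes partition \<open>G\<close>, summing class by
  class yields the formula (\<open>sum_subgroups_eq_sum_conjugacy_classes\<close>).
\<close>

lemma (in group) conjugation_group_hom:
  assumes "k \<in> carrier G"
  shows "group_hom G G (\<lambda>h. k \<otimes> h \<otimes> inv k)"
proof (unfold_locales, rule homI)
  fix x y assume xy: "x \<in> carrier G" "y \<in> carrier G"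
  have "inv k \<otimes> (k \<otimes> (y \<otimes> inv k)) = y \<otimes> inv k"
    using assms xy by (simp add: m_assoc[symmetric])
  then show "k \<otimes> (x \<otimes> y) \<otimes> inv k = (k \<otimes> x \<otimes> inv k) \<otimes> (k \<otimes> y \<otimes> inv k)"
    using assms xy by (simp add: m_assoc)
qed (use assms in simp)

lemma (in group) conjugation_inv_cancel:
  assumes "k \<in> carrier G" "x \<in> carrier G"
  shows "inv k \<otimes> (k \<otimes> x \<otimes> inv k) \<otimes> k = x" "k \<otimes> (inv k \<otimes> x \<otimes> k) \<otimes> inv k = x"
proof -
  have "inv k \<otimes> (k \<otimes> x) = x" "k \<otimes> (inv k \<otimes> x) = x"
    using assms by (simp_all add: m_assoc[symmetric])
  then show "inv k \<otimes> (k \<otimes> x \<otimes> inv k) \<otimes> k = x" "k \<otimes> (inv k \<otimes> x \<otimes> k) \<otimes> inv k = x"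
    using assms by (simp_all add: m_assoc)
qed


section \<open>Class functions on a finite group\<close>

text \<open>
  The terms of the two sums correspond under \<open>H \<mapsto> kHk\<^sup>-\<^sup>1\<close>, whose inverse is conjugation
  by \<open>k\<^sup>-\<^sup>1\<close>.
\<close>

lemma (in group) subgroup_weight_conj:
  assumes k: "k \<in> carrier G" and g: "g \<in> carrier G"
  shows "subgroup_weight G (k \<otimes> g \<otimes> inv k) = subgroup_weight G g"
proof -
  define \<alpha> where "\<alpha> k h = k \<otimes> h \<otimes> inv k" for k h
  have inj: "inj_on (\<alpha> k) H" if "subgroup H G" for H
    using conjugation_is_inj[OF k] subgroup.mem_carrier[OF that]
    by (auto simp: inj_on_def \<alpha>_def)
  have sub: "subgroup (\<alpha> l ` H) G" if "subgroup H G" "l \<in> carrier G" for l H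
    using group_hom.subgroup_img_is_subgroup[OF conjugation_group_hom] that
    by (simp add: \<alpha>_def)
  have cancel: "\<alpha> (inv k) ` \<alpha> k ` H = H" "\<alpha> k ` \<alpha> (inv k) ` H = H" if "subgroup H G" for H
  proof -
    have "\<alpha> (inv k) (\<alpha> k h) = h" "\<alpha> k (\<alpha> (inv k) h) = h" if "h \<in> H" for h
      using conjugation_inv_cancel[OF k] subgroup.mem_carrier[OF \<open>subgroup H G\<close> that] k
      by (simp_all add: \<alpha>_def)
    then show "\<alpha> (inv k) ` \<alpha> k ` H = H" "\<alpha> k ` \<alpha> (inv k) ` H = H"
      by (simp_all add: image_image)
  qed
  have undo_g: "\<alpha> (inv k) (\<alpha> k g) = g"
    using conjugation_inv_cancel[OF k g] k by (simp add: \<alpha>_def)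
  have "subgroup_weight G g = subgroup_weight G (\<alpha> k g)"
    unfolding subgroup_weight_def
  proof (rule sum.reindex_bij_witness[where i = "\<lambda>H. \<alpha> (inv k) ` H" and j = "\<lambda>H. \<alpha> k ` H"])
    fix H assume H: "H \<in> {H. subgroup H G \<and> g \<in> H}"
    then show "\<alpha> (inv k) ` \<alpha> k ` H = H" "\<alpha> k ` H \<in> {H. subgroup H G \<and> \<alpha> k g \<in> H}"
      using cancel sub k by auto
    show "(1 :: rat) / of_nat (card (\<alpha> k ` H)) = 1 / of_nat (card H)"
      using H inj by (simp add: card_image)
  next
    fix H assume "H \<in> {H. subgroup H G \<and> \<alpha> k g \<in> H}"
    then show "\<alpha> k ` \<alpha> (inv k) ` H = H" "\<alpha> (inv k) ` H \<in> {H. subgroup H G \<and> g \<in> H}"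
      using cancel sub k image_eqI[of g "\<alpha> (inv k)" "\<alpha> k g" H] undo_g by auto
  qed
  then show ?thesis by (simp add: \<alpha>_def)
qed

lemma (in group) conjugacy_classE:
  assumes "C \<in> conjugacy_classes G" "g \<in> C" "h \<in> C"
  obtains k where "k \<in> carrier G" "h = k \<otimes> g \<otimes> inv k"
proof -
  interpret conj: group_action G "carrier G" "\<lambda>g. \<lambda>h\<in>carrier G. g \<otimes> h \<otimes> inv g"
    by (rule action_by_conjugation)
  obtain x where x: "x \<in> carrier G"
    "C = orbit G (\<lambda>g. \<lambda>h\<in>carrier G. g \<otimes> h \<otimes> inv g) x"
    using assms(1) by (auto simp: conjugacy_classes_def orbits_def)
  have gh: "g \<in> carrier G" "h \<in> carrier G"
    using assms(2,3) x by (auto simp: orbit_def)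
  then have "h \<in> orbit G (\<lambda>g. \<lambda>h\<in>carrier G. g \<otimes> h \<otimes> inv g) g"
    using assms(2,3) x conj.orbit_sym conj.orbit_trans by blast
  then show thesis
    using that gh by (auto simp: orbit_def)
qed

lemma (in group) conjugacy_class_subset:
  assumes "C \<in> conjugacy_classes G"
  shows "C \<subseteq> carrier G"
  using assms by (auto simp: conjugacy_classes_def orbits_def orbit_def)

text \<open>
  Exchanging the two sums collects the weight of each group element; a class function times this
  weight is then constant on each class. Nothing but linearity is asked of the values, so they may
  lie in any rational vector space.
\<close>

lemma (in group) sum_subgroups_eq_sum_conjugacy_classes:
  fixes scale :: "rat \<Rightarrow> 'v :: ab_group_add \<Rightarrow> 'v" and f :: "'a \<Rightarrow> 'v"
  assumes "vector_space scale"
    and fin: "finite (carrier G)"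
    and f: "\<And>k g. k \<in> carrier G \<Longrightarrow> g \<in> carrier G \<Longrightarrow> f (k \<otimes> g \<otimes> inv k) = f g"
    and rep: "\<And>C. C \<in> conjugacy_classes G \<Longrightarrow> rep C \<in> C"
  shows "(\<Sum>H | subgroup H G. scale (1 / of_nat (card H)) (\<Sum>h\<in>H. f h)) =
    (\<Sum>C\<in>conjugacy_classes G. scale (of_nat (card C) * subgroup_weight G (rep C)) (f (rep C)))"
proof -
  interpret vector_space scale by fact
  interpret conj: group_action G "carrier G" "\<lambda>g. \<lambda>h\<in>carrier G. g \<otimes> h \<otimes> inv g"
    by (rule action_by_conjugation)
  have finS: "finite {H. subgroup H G}"
    by (rule finite_subset[of _ "Pow (carrier G)"]) (use fin subgroup.subset in auto)
  have on_class: "(\<Sum>g\<in>C. scale (subgroup_weight G g) (f g)) =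
      scale (of_nat (card C) * subgroup_weight G (rep C)) (f (rep C))"
    if C: "C \<in> conjugacy_classes G" for C
  proof -
    have "scale (subgroup_weight G g) (f g) = scale (subgroup_weight G (rep C)) (f (rep C))"
      if g: "g \<in> C" for g
    proof -
      obtain k where "k \<in> carrier G" "g = k \<otimes> rep C \<otimes> inv k"
        using conjugacy_classE[OF C rep[OF C] g] .
      moreover have "rep C \<in> carrier G"
        using conjugacy_class_subset[OF C] rep[OF C] by blast
      ultimately show ?thesis
        using f subgroup_weight_conj by simp
    qed
    then have "(\<Sum>g\<in>C. scale (subgroup_weight G g) (f g)) =
        (\<Sum>g\<in>C. scale (subgroup_weight G (rep C)) (f (rep C)))"
      by (rule sum.cong[OF refl])
    then show ?thesis
      by (simp add: scale_sum_left[symmetric])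
  qed
  have "(\<Sum>H | subgroup H G. scale (1 / of_nat (card H)) (\<Sum>h\<in>H. f h)) =
      (\<Sum>H | subgroup H G. \<Sum>h | h \<in> carrier G \<and> h \<in> H. scale (1 / of_nat (card H)) (f h))"
    by (intro sum.cong[OF refl])
      (auto simp: scale_sum_right dest: subgroup.mem_carrier intro!: sum.cong)
  also have "\<dots> = (\<Sum>h\<in>carrier G. \<Sum>H | H \<in> {H. subgroup H G} \<and> h \<in> H.
      scale (1 / of_nat (card H)) (f h))"
    by (rule sum.swap_restrict[OF finS fin])
  also have "\<dots> = (\<Sum>g\<in>carrier G. scale (subgroup_weight G g) (f g))"
    by (simp add: subgroup_weight_def scale_sum_left)
  also have "\<dots> = (\<Sum>C\<in>conjugacy_classes G. \<Sum>g\<in>C. scale (subgroup_weight G g) (f g))"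
    unfolding conjugacy_classes_def by (rule conj.disjoint_sum[OF fin, symmetric])
  finally show ?thesis
    using on_class by simp
qed


section \<open>Conjugate automorphisms have isomorphic quotient graphs\<close>

text \<open>
  Composition with the isomorphism turns the colourings of one graph into those of the other, so
  the two polynomials are defined by the same counting function.
\<close>

lemma bivariate_chromatic_iso:
  assumes bij: "bij_betw f (pverts \<Lambda>) (pverts \<Lambda>')"
    and arcs: "parcs \<Lambda> \<subseteq> pverts \<Lambda> \<times> pverts \<Lambda>" "parcs \<Lambda>' = map_prod f f ` parcs \<Lambda>"
  shows "bivariate_chromatic \<Lambda>' = bivariate_chromatic \<Lambda>"
proof -
  let ?g = "inv_into (pverts \<Lambda>) f"
  have g: "?g v \<in> pverts \<Lambda>" "f (?g v) = v" if "v \<in> pverts \<Lambda>'" for v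
    using that bij by (auto simp: bij_betw_def inv_into_into f_inv_into_f)
  have f: "f v \<in> pverts \<Lambda>'" "?g (f v) = v" if "v \<in> pverts \<Lambda>" for v
    using that bij by (auto simp: bij_betw_def)
  have "card (bichromatic_colourings \<Lambda>' x y) = card (bichromatic_colourings \<Lambda> x y)" for x y
  proof (rule bij_betw_same_card[OF bij_betw_byWitness[where
        f = "\<lambda>c. \<lambda>v\<in>pverts \<Lambda>. c (f v)" and f' = "\<lambda>c. \<lambda>v\<in>pverts \<Lambda>'. c (?g v)"]])
    show "\<forall>c\<in>bichromatic_colourings \<Lambda>' x y.
        (\<lambda>v\<in>pverts \<Lambda>'. (\<lambda>v\<in>pverts \<Lambda>. c (f v)) (?g v)) = c"
      by (auto simp: bichromatic_colourings_def fun_eq_iff g PiE_def extensional_def)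
    show "\<forall>c\<in>bichromatic_colourings \<Lambda> x y.
        (\<lambda>v\<in>pverts \<Lambda>. (\<lambda>v\<in>pverts \<Lambda>'. c (?g v)) (f v)) = c"
      by (auto simp: bichromatic_colourings_def fun_eq_iff f PiE_def extensional_def)
    show "(\<lambda>c. \<lambda>v\<in>pverts \<Lambda>. c (f v)) ` bichromatic_colourings \<Lambda>' x y
        \<subseteq> bichromatic_colourings \<Lambda> x y"
      using arcs f by (fastforce simp: bichromatic_colourings_def PiE_def Pi_def)
    show "(\<lambda>c. \<lambda>v\<in>pverts \<Lambda>'. c (?g v)) ` bichromatic_colourings \<Lambda> x y
        \<subseteq> bichromatic_colourings \<Lambda>' x y"
    proof (rule image_subsetI)
      fix c assume "c \<in> bichromatic_colourings \<Lambda> x y"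
      then have c: "c \<in> pverts \<Lambda> \<rightarrow>\<^sub>E {1..x}"
        and proper: "\<And>u v. (u, v) \<in> parcs \<Lambda> \<Longrightarrow> c u = c v \<Longrightarrow> y < c u"
        unfolding bichromatic_colourings_def by blast+
      have "(\<lambda>v\<in>pverts \<Lambda>'. c (?g v)) \<in> pverts \<Lambda>' \<rightarrow>\<^sub>E {1..x}"
        using PiE_mem[OF c g(1)] by (simp add: PiE_def Pi_def)
      moreover have "y < c (?g (f u))"
        if "(u, v) \<in> parcs \<Lambda>" "c (?g (f u)) = c (?g (f v))" for u v
      proof -
        have "u \<in> pverts \<Lambda>" "v \<in> pverts \<Lambda>" using that(1) arcs(1) by blast+
        then show ?thesis using proper[OF that(1)] that(2) by (simp add: f)
      qed
      moreover have "f u \<in> pverts \<Lambda>'" "f v \<in> pverts \<Lambda>'" if "(u, v) \<in> parcs \<Lambda>" for u v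
        using that arcs(1) f(1) by blast+
      ultimately show "(\<lambda>v\<in>pverts \<Lambda>'. c (?g v)) \<in> bichromatic_colourings \<Lambda>' x y"
        by (auto simp: bichromatic_colourings_def arcs(2))
    qed
  qed
  then show ?thesis
    by (simp add: bivariate_chromatic_def)
qed

lemma carrier_aut_group [simp]: "carrier (aut_group \<Gamma>) = graph_aut \<Gamma>"
  by (simp add: aut_group_def)

lemma group_action_aut_group: "group_action (aut_group \<Gamma>) (pverts \<Gamma>) (\<lambda>f. f)"
proof -
  have "(\<lambda>f. f) \<in> hom (aut_group \<Gamma>) (BijGroup (pverts \<Gamma>))"
    by (rule homI) (auto simp: aut_group_def BijGroup_def graph_aut_def)
  then show ?thesis
    by (simp add: group_action_def group_hom_def group_hom_axioms_def group_aut_group group_BijGroup)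
qed

text \<open>
  Since \<open>\<langle>kgk\<^sup>-\<^sup>1\<rangle> = k\<langle>g\<rangle>k\<^sup>-\<^sup>1\<close>, the orbit of \<open>k x\<close> under the conjugate is the \<open>k\<close>-image of the
  orbit of \<open>x\<close>; every vertex has the form \<open>k x\<close>.
\<close>

lemma cyclic_orbits_conj:
  assumes k: "k \<in> graph_aut \<Gamma>" and g: "g \<in> graph_aut \<Gamma>"
  shows "cyclic_orbits \<Gamma> (k \<otimes>\<^bsub>aut_group \<Gamma>\<^esub> g \<otimes>\<^bsub>aut_group \<Gamma>\<^esub> inv\<^bsub>aut_group \<Gamma>\<^esub> k) =
    (`) k ` cyclic_orbits \<Gamma> g"
proof -
  let ?A = "aut_group \<Gamma>"
  interpret A: group ?A by (rule group_aut_group)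
  interpret act: group_action ?A "pverts \<Gamma>" "\<lambda>f. f" by (rule group_action_aut_group)
  define \<alpha> where "\<alpha> h = k \<otimes>\<^bsub>?A\<^esub> h \<otimes>\<^bsub>?A\<^esub> inv\<^bsub>?A\<^esub> k" for h
  define O' where "O' g x = (\<lambda>f. f x) ` generate ?A {g}" for g x
  have orbits: "cyclic_orbits \<Gamma> g = O' g ` pverts \<Gamma>" for g
    by (auto simp: cyclic_orbits_def orbits_def orbit_def O'_def)
  have gen: "generate ?A {\<alpha> g} = \<alpha> ` generate ?A {g}"
    using group_hom.generate_img[OF A.conjugation_group_hom[of k], of "{g}"] k g
    by (simp add: \<alpha>_def)
  have app: "\<alpha> h (k x) = k (h x)" if h: "h \<in> generate ?A {g}" and x: "x \<in> pverts \<Gamma>" for h x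
  proof -
    have h: "h \<in> graph_aut \<Gamma>"
      using A.generate_in_carrier[OF _ h] g by simp
    have kx: "k x \<in> pverts \<Gamma>"
      using act.element_image[of k x "k x"] k x by simp
    have ik: "inv\<^bsub>?A\<^esub> k \<in> graph_aut \<Gamma>" and kh: "k \<otimes>\<^bsub>?A\<^esub> h \<in> graph_aut \<Gamma>"
      using k h A.inv_closed A.m_closed by simp_all
    have "\<alpha> h (k x) = (k \<otimes>\<^bsub>?A\<^esub> h) ((inv\<^bsub>?A\<^esub> k) (k x))"
      using act.composition_rule[OF kx, of "k \<otimes>\<^bsub>?A\<^esub> h" "inv\<^bsub>?A\<^esub> k"] kh ik
      by (simp add: \<alpha>_def)
    also have "(inv\<^bsub>?A\<^esub> k) (k x) = x"
      using act.orbit_sym_aux[of k x "k x"] k x by simp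
    also have "(k \<otimes>\<^bsub>?A\<^esub> h) x = k (h x)"
      using act.composition_rule[OF x, of k h] k h by simp
    finally show ?thesis .
  qed
  have "O' (\<alpha> g) (k x) = k ` O' g x" if "x \<in> pverts \<Gamma>" for x
    unfolding O'_def gen image_image by (intro image_cong refl app that)
  moreover have "k ` pverts \<Gamma> = pverts \<Gamma>"
    using k by (simp add: graph_aut_def Bij_def bij_betw_def)
  ultimately have "O' (\<alpha> g) ` pverts \<Gamma> = (`) k ` O' g ` pverts \<Gamma>"
    by (metis (no_types, lifting) image_cong image_image)
  then show ?thesis
    by (simp add: orbits \<alpha>_def)
qed

lemma cyclic_orbit_subset:
  assumes "g \<in> graph_aut \<Gamma>" "A \<in> cyclic_orbits \<Gamma> g"
  shows "A \<subseteq> pverts \<Gamma>"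
proof
  interpret A: group "aut_group \<Gamma>" by (rule group_aut_group)
  interpret act: group_action "aut_group \<Gamma>" "pverts \<Gamma>" "\<lambda>f. f" by (rule group_action_aut_group)
  fix u assume "u \<in> A"
  then obtain x f where "x \<in> pverts \<Gamma>" "f \<in> generate (aut_group \<Gamma>) {g}" "u = f x"
    using assms(2) by (auto simp: cyclic_orbits_def orbits_def orbit_def)
  then show "u \<in> pverts \<Gamma>"
    using A.generate_in_carrier[of "{g}" f] assms(1) act.element_image[of f x u] by simp
qed

text \<open>
  Taking images under \<open>k\<close> matches the orbits, and it preserves and reflects adjacency, loops
  included, because \<open>k\<close> does so for the edges between representatives.
\<close>

lemma bivariate_chromatic_quotient_conj:
  assumes k: "k \<in> graph_aut \<Gamma>" and g: "g \<in> graph_aut \<Gamma>"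
  shows "bivariate_chromatic
      (quotient_graph \<Gamma> (k \<otimes>\<^bsub>aut_group \<Gamma>\<^esub> g \<otimes>\<^bsub>aut_group \<Gamma>\<^esub> inv\<^bsub>aut_group \<Gamma>\<^esub> k)) =
    bivariate_chromatic (quotient_graph \<Gamma> g)"
proof (rule bivariate_chromatic_iso[where f = "(`) k"])
  let ?g' = "k \<otimes>\<^bsub>aut_group \<Gamma>\<^esub> g \<otimes>\<^bsub>aut_group \<Gamma>\<^esub> inv\<^bsub>aut_group \<Gamma>\<^esub> k"
  have inj: "inj_on k (pverts \<Gamma>)"
    and arc: "\<And>u v. u \<in> pverts \<Gamma> \<Longrightarrow> v \<in> pverts \<Gamma> \<Longrightarrow> (k u, k v) \<in> parcs \<Gamma> \<longleftrightarrow> (u, v) \<in> parcs \<Gamma>"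
    using k by (auto simp: graph_aut_def Bij_def bij_betw_def)
  have sub: "A \<subseteq> pverts \<Gamma>" if "A \<in> cyclic_orbits \<Gamma> g" for A
    using cyclic_orbit_subset[OF g that] .
  have "inj_on ((`) k) (cyclic_orbits \<Gamma> g)"
    by (rule inj_on_subset[OF inj_on_image_Pow[OF inj]]) (use sub in blast)
  then show "bij_betw ((`) k) (pverts (quotient_graph \<Gamma> g)) (pverts (quotient_graph \<Gamma> ?g'))"
    by (simp add: quotient_graph_def bij_betw_def cyclic_orbits_conj[OF k g])
  show "parcs (quotient_graph \<Gamma> g)
      \<subseteq> pverts (quotient_graph \<Gamma> g) \<times> pverts (quotient_graph \<Gamma> g)"
    by (auto simp: quotient_graph_def)
  define adj where "adj A B \<longleftrightarrow> (\<exists>u\<in>A. \<exists>v\<in>B. (u, v) \<in> parcs \<Gamma>)" for A B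
  have parcs: "parcs (quotient_graph \<Gamma> h) =
      {(A, B). A \<in> cyclic_orbits \<Gamma> h \<and> B \<in> cyclic_orbits \<Gamma> h \<and> adj A B}" for h
    by (simp add: quotient_graph_def adj_def)
  have "adj (k ` A) (k ` B) \<longleftrightarrow> adj A B"
    if "A \<in> cyclic_orbits \<Gamma> g" "B \<in> cyclic_orbits \<Gamma> g" for A B
    using sub[OF that(1)] sub[OF that(2)] arc unfolding adj_def by blast
  then show "parcs (quotient_graph \<Gamma> ?g') =
      map_prod ((`) k) ((`) k) ` parcs (quotient_graph \<Gamma> g)"
    unfolding parcs cyclic_orbits_conj[OF k g] by auto
qed


section \<open>The formula for the multiorbital polynomial\<close>

lemma finite_graph_aut:
  assumes "finite (pverts \<Gamma>)"
  shows "finite (graph_aut \<Gamma>)"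
proof (rule finite_subset)
  show "graph_aut \<Gamma> \<subseteq> pverts \<Gamma> \<rightarrow>\<^sub>E pverts \<Gamma>"
    by (auto simp: graph_aut_def Bij_def bij_betw_def PiE_def)
  show "finite (pverts \<Gamma> \<rightarrow>\<^sub>E pverts \<Gamma>)"
    by (intro finite_PiE assms)
qed

theorem proposition3p7:
  fixes \<Gamma> :: "'a pair_pre_digraph"
    and G :: "('a \<Rightarrow> 'a) set"
    and rep :: "('a \<Rightarrow> 'a) set \<Rightarrow> ('a \<Rightarrow> 'a)"
  assumes "pair_pseudo_graph \<Gamma>"
    and "subgroup G (aut_group \<Gamma>)"
    and "\<And>C. C \<in> conjugacy_classes (aut_group \<Gamma> \<lparr>carrier := G\<rparr>) \<Longrightarrow> rep C \<in> C"
  shows "multiorbital_bivariate_chromatic \<Gamma> G =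
    (\<Sum>C\<in>conjugacy_classes (aut_group \<Gamma> \<lparr>carrier := G\<rparr>).
       smult [:of_nat (card C) * subgroup_weight (aut_group \<Gamma> \<lparr>carrier := G\<rparr>) (rep C):]
         (bivariate_chromatic (quotient_graph \<Gamma> (rep C))))"
proof -
  let ?G = "aut_group \<Gamma> \<lparr>carrier := G\<rparr>"
  interpret pair_pseudo_graph \<Gamma> by fact
  interpret A: group "aut_group \<Gamma>" by (rule group_aut_group)
  interpret G: group ?G by (rule A.subgroup_imp_group[OF assms(2)])
  have G: "G \<subseteq> graph_aut \<Gamma>"
    using subgroup.subset[OF assms(2)] by simp
  have vs: "vector_space (\<lambda>q :: rat. smult [:q:] :: rat poly poly \<Rightarrow> _)"
    by unfold_locales
      (simp_all add: smult_add_right smult_add_left[symmetric] one_pCons[symmetric] mult.commute)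
  have fin: "finite (carrier ?G)"
    using finite_subset[OF G finite_graph_aut] by simp
  \<comment> \<open>Conjugation in \<open>G\<close> is the restriction of conjugation in the full automorphism group.\<close>
  have "bivariate_chromatic (quotient_graph \<Gamma> (k \<otimes>\<^bsub>?G\<^esub> g \<otimes>\<^bsub>?G\<^esub> inv\<^bsub>?G\<^esub> k)) =
      bivariate_chromatic (quotient_graph \<Gamma> g)" if "k \<in> carrier ?G" "g \<in> carrier ?G" for k g
    using bivariate_chromatic_quotient_conj[of k \<Gamma> g] that G A.m_inv_consistent[OF assms(2)]
    by auto
  then show ?thesis
    unfolding multiorbital_bivariate_chromatic_def
    by (intro G.sum_subgroups_eq_sum_conjugacy_classes[OF vs fin _ assms(3)])
qed

end
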